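(* Let $R$ be a commutative ring with nonzero identity and let $a,b\in R^\#$. Then \[ [b]\in B_a\quad\Longleftrightarrow\quad \sqrt{aR}\subseteq\sqrt{bR}. \] Equivalently, \[ B_a\subseteq B_b\quad\Longleftrightarrow\quad \sqrt{bR}\subseteq\sqrt{aR}. \]
   Context: For a commutative ring $R$ with nonzero identity and unit group $U(R)$, let $R^\#=R\setminus(U(R)\cup\{0\})$ be the set of nonzero nonunits. For $a,b\in R^\#$ write $a\sim b$ if $aR=bR$; $[a]$ denotes the equivalence class of $a$ and $EC(R^\#)$ the set of equivalence classes. For $a\in R^\#$ put $B_a=\{[b]\in EC(R^\#): b\mid a^n\text{ for some }n\geq 1\}$, where $b\mid a^n$ means $a^n\in bR$. Here $\sqrt{I}$ denotes the radical of the ideal $I$. *)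

theory Defs
  imports "HOL-Algebra.Ideal"
begin

definition nz_nonunits :: "('a, 'm) ring_scheme \<Rightarrow> 'a set" where
  "nz_nonunits R = carrier R - (Units R \<union> {\<zero>\<^bsub>R\<^esub>})"

(* The relation a ~ b on the nonzero nonunits: aR = bR. The library's PIdl a is aR. *)
definition same_ideal_rel :: "('a, 'm) ring_scheme \<Rightarrow> ('a \<times> 'a) set" where
  "same_ideal_rel R =
     {(a, b). a \<in> nz_nonunits R \<and> b \<in> nz_nonunits R \<and> PIdl\<^bsub>R\<^esub> a = PIdl\<^bsub>R\<^esub> b}"

definition eclass :: "('a, 'm) ring_scheme \<Rightarrow> 'a \<Rightarrow> 'a set" where
  "eclass R a = same_ideal_rel R `` {a}"

definition EC :: "('a, 'm) ring_scheme \<Rightarrow> 'a set set" where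
  "EC R = nz_nonunits R // same_ideal_rel R"

(* A class belongs to this set as soon as one of its representatives b satisfies
   "b divides a^n for some n >= 1", divisibility meaning that a^n lies in bR. *)
definition divisor_classes :: "('a, 'm) ring_scheme \<Rightarrow> 'a \<Rightarrow> 'a set set" where
  "divisor_classes R a =
     {eclass R b | b. eclass R b \<in> EC R \<and> b \<in> nz_nonunits R \<and>
        (\<exists>n::nat. n \<ge> 1 \<and> a [^]\<^bsub>R\<^esub> n \<in> PIdl\<^bsub>R\<^esub> b)}"

definition radical :: "('a, 'm) ring_scheme \<Rightarrow> 'a set \<Rightarrow> 'a set" where
  "radical R I = {x \<in> carrier R. \<exists>n::nat. n \<ge> 1 \<and> x [^]\<^bsub>R\<^esub> n \<in> I}"

lemma equiv_same_ideal_rel: "equiv (nz_nonunits R) (same_ideal_rel R)"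
  by (rule equivI) (auto simp: same_ideal_rel_def intro: refl_onI symI transI)

end

theory Submission
  imports Defs
begin

text \<open>
  Inclusion between radicals of principal ideals is a divisibility statement about the
  generators: \<open>a\<close> lies in the radical of \<open>aR\<close>, so an inclusion of radicals puts some power of
  \<open>a\<close> into \<open>bR\<close>; conversely, if a power of \<open>a\<close> lies in \<open>bR\<close>, then so does a suitable power of any
  element having a power in \<open>aR\<close>. This is \<open>radical_cgenideal_subset_iff\<close>. On the other side, whether
  \<open>b\<close> divides a power of \<open>a\<close> depends on \<open>b\<close> only through \<open>bR\<close>, hence only through the class of
  \<open>b\<close> (\<open>eclass_in_divisor_classes_iff\<close>). The two facts together give the criterion for membership
  of a class.

  The criterion for inclusion follows formally. Write \<open>B\<^sub>a\<close> for the set of divisor classes of \<open>a\<close>.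
  The class of \<open>a\<close> belongs to \<open>B\<^sub>a\<close>, so \<open>B\<^sub>a \<subseteq> B\<^sub>b\<close> puts it into \<open>B\<^sub>b\<close>, which says that the radical of \<open>bR\<close> is
  contained in that of \<open>aR\<close>. For the converse, each class \<open>[c]\<close> in \<open>B\<^sub>a\<close> is characterised by the
  radical of \<open>cR\<close> containing that of \<open>aR\<close>, and inclusion is transitive.
\<close>

lemma nz_nonunits_carrier: "a \<in> nz_nonunits R \<Longrightarrow> a \<in> carrier R"
  by (simp add: nz_nonunits_def)

lemma eclass_eq_iff:
  assumes "b \<in> nz_nonunits R" and "c \<in> nz_nonunits R"
  shows "eclass R b = eclass R c \<longleftrightarrow> PIdl\<^bsub>R\<^esub> b = PIdl\<^bsub>R\<^esub> c"
proof -
  have "eclass R b = eclass R c \<longleftrightarrow> (b, c) \<in> same_ideal_rel R"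
    unfolding eclass_def using equiv_same_ideal_rel assms by (rule eq_equiv_class_iff)
  then show ?thesis
    using assms by (simp add: same_ideal_rel_def)
qed

text \<open>
  Membership asks for some representative of the class to divide a power of \<open>a\<close>. Equivalent
  elements generate the same ideal, so any given representative may be tested instead.
\<close>

lemma eclass_in_divisor_classes_iff:
  assumes "b \<in> nz_nonunits R"
  shows "eclass R b \<in> divisor_classes R a
     \<longleftrightarrow> (\<exists>n::nat. n \<ge> 1 \<and> a [^]\<^bsub>R\<^esub> n \<in> PIdl\<^bsub>R\<^esub> b)"
proof
  assume "eclass R b \<in> divisor_classes R a"
  then obtain c n where "eclass R b = eclass R c" "c \<in> nz_nonunits R"
    "n \<ge> (1::nat)" "a [^]\<^bsub>R\<^esub> n \<in> PIdl\<^bsub>R\<^esub> c"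
    by (auto simp: divisor_classes_def)
  then show "\<exists>n::nat. n \<ge> 1 \<and> a [^]\<^bsub>R\<^esub> n \<in> PIdl\<^bsub>R\<^esub> b"
    using eclass_eq_iff[OF assms] by blast
next
  have "eclass R b \<in> EC R"
    unfolding EC_def eclass_def using assms by (rule quotientI)
  moreover assume "\<exists>n::nat. n \<ge> 1 \<and> a [^]\<^bsub>R\<^esub> n \<in> PIdl\<^bsub>R\<^esub> b"
  ultimately show "eclass R b \<in> divisor_classes R a"
    using assms by (auto simp: divisor_classes_def)
qed

lemma (in cring) generator_in_radical:
  assumes "a \<in> carrier R"
  shows "a \<in> radical R (PIdl a)"
proof -
  have "a [^] (1::nat) \<in> PIdl a"
    using assms by (simp add: cgenideal_self)
  then show ?thesis
    using assms by (auto simp: radical_def)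
qed

text \<open>
  For the backward direction, raise an equation \<open>x\<^sup>m = r a\<close> to the power \<open>n\<close>: by commutativity
  \<open>x\<^sup>m\<^sup>n = r\<^sup>n a\<^sup>n\<close>, a multiple of \<open>a\<^sup>n\<close> and so an element of \<open>bR\<close>.
\<close>

lemma (in cring) radical_cgenideal_subset_iff:
  assumes a: "a \<in> carrier R" and b: "b \<in> carrier R"
  shows "radical R (PIdl a) \<subseteq> radical R (PIdl b)
     \<longleftrightarrow> (\<exists>n::nat. n \<ge> 1 \<and> a [^] n \<in> PIdl b)"
proof
  assume "radical R (PIdl a) \<subseteq> radical R (PIdl b)"
  then have "a \<in> radical R (PIdl b)"
    using generator_in_radical[OF a] by blast
  then show "\<exists>n::nat. n \<ge> 1 \<and> a [^] n \<in> PIdl b"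
    by (simp add: radical_def)
next
  assume "\<exists>n::nat. n \<ge> 1 \<and> a [^] n \<in> PIdl b"
  then obtain n :: nat where n: "n \<ge> 1" "a [^] n \<in> PIdl b" by blast
  show "radical R (PIdl a) \<subseteq> radical R (PIdl b)"
  proof
    fix x assume "x \<in> radical R (PIdl a)"
    then obtain m :: nat and r where x: "x \<in> carrier R" and m: "m \<ge> 1"
      and r: "r \<in> carrier R" "x [^] m = r \<otimes> a"
      by (auto simp: radical_def cgenideal_def)
    have "x [^] (m * n) = (r \<otimes> a) [^] n"
      using x r by (simp add: nat_pow_pow[symmetric])
    also have "\<dots> = r [^] n \<otimes> a [^] n"
      using r(1) a by (rule nat_pow_distrib)
    also have "\<dots> \<in> PIdl b"
      using ideal.I_l_closed[OF cgenideal_ideal[OF b] n(2)] r(1) by simp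
    finally have "x [^] (m * n) \<in> PIdl b" .
    moreover have "m * n \<ge> 1"
      using m n(1) by simp
    ultimately show "x \<in> radical R (PIdl b)"
      using x unfolding radical_def by blast
  qed
qed

lemma (in cring) eclass_in_divisor_classes_iff_radical:
  assumes "a \<in> nz_nonunits R" and "b \<in> nz_nonunits R"
  shows "eclass R b \<in> divisor_classes R a
     \<longleftrightarrow> radical R (PIdl a) \<subseteq> radical R (PIdl b)"
  using assms
  by (simp add: eclass_in_divisor_classes_iff radical_cgenideal_subset_iff nz_nonunits_carrier)

theorem lemma1p1:
  fixes R (structure) and a b :: 'a
  assumes "cring R" and "\<one> \<noteq> \<zero>"
    and "a \<in> nz_nonunits R" and "b \<in> nz_nonunits R"
  shows "(eclass R b \<in> divisor_classes R a \<longleftrightarrow>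
            radical R (PIdl a) \<subseteq> radical R (PIdl b))
       \<and> (divisor_classes R a \<subseteq> divisor_classes R b \<longleftrightarrow>
            radical R (PIdl b) \<subseteq> radical R (PIdl a))"
proof -
  note crit = cring.eclass_in_divisor_classes_iff_radical[OF assms(1)]
  note a = assms(3) and b = assms(4)
  have "divisor_classes R a \<subseteq> divisor_classes R b \<longleftrightarrow>
      radical R (PIdl b) \<subseteq> radical R (PIdl a)"
  proof
    assume "divisor_classes R a \<subseteq> divisor_classes R b"
    moreover have "eclass R a \<in> divisor_classes R a"
      by (simp add: crit[OF a a])
    ultimately show "radical R (PIdl b) \<subseteq> radical R (PIdl a)"
      using crit[OF b a] by blast
  next
    assume ba: "radical R (PIdl b) \<subseteq> radical R (PIdl a)"
    show "divisor_classes R a \<subseteq> divisor_classes R b"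
    proof
      fix C assume C: "C \<in> divisor_classes R a"
      then obtain c where c: "c \<in> nz_nonunits R" and Cc: "C = eclass R c"
        by (auto simp: divisor_classes_def)
      have "radical R (PIdl a) \<subseteq> radical R (PIdl c)"
        using C crit[OF a c] by (simp add: Cc)
      with ba have "radical R (PIdl b) \<subseteq> radical R (PIdl c)"
        by (rule subset_trans)
      then show "C \<in> divisor_classes R b"
        using crit[OF b c] by (simp add: Cc)
    qed
  qed
  with crit[OF a b] show ?thesis by blast
qed

end
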